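(* Let $\mathcal{N}$ be the $\binom{5}{2}$ combination network, i.e. the network with source $S$, intermediate vertices $V_1,\dots,V_5$, terminals $T_{\{i,j\}}$ for the ten 2-element subsets $\{i,j\}\subseteq\{1,\dots,5\}$, exactly one edge from $S$ to each $V_i$, exactly one edge from $V_i$ to $T_{\{i,j\}}$ for all $i\neq j$, and no other edges. Let $q$ be a prime power and $\mathcal{A}=\mathbb{F}_q$. Then $$\mathrm{C}_1^{\mathrm{lin}}(\mathcal{N},\mathcal{A})=\begin{cases}1 & \text{if } q=2,\\ \log_3 6 & \text{if } q=3,\\ 2 & \text{otherwise.}\end{cases}$$
   Context: A (single-source) network is a tuple $\mathcal{N}=(\mathcal{V},\mathcal{E},S,\mathbf{T})$ where $(\mathcal{V},\mathcal{E})$ is a finite directed acyclic multigraph, $S\in\mathcal{V}$ is the source, $\mathbf{T}\subseteq\mathcal{V}\setminus\{S\}$ is a nonempty set of terminals, the source has no incoming edges, terminals have no outgoing edges, there is a directed path from $S$ to every terminal, and every other (intermediate) vertex lies on a directed path from $S$ to it and has a directed path to some terminal. $\mathrm{in}(V)$ and $\mathrm{out}(V)$ denote the sets of incoming and outgoing edges of $V$. An alphabet $\mathcal{A}$ is a finite set with at least 2 elements; each edge carries exactly one symbol of $\mathcal{A}$. The edges are totally ordered by some fixed total order extending the partial order "$e\preccurlyeq e'$ if there is a directed path starting with $e$ and ending with $e'$" (the choice of extension does not matter), and this is used to index coordinates. A network code for $(\mathcal{N},\mathcal{A})$ is a family $\mathcal{F}=\{\mathcal{F}_V\}$, indexed by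 the intermediate vertices, of functions $\mathcal{F}_V:\mathcal{A}^{|\mathrm{in}(V)|}\to\mathcal{A}^{|\mathrm{out}(V)|}$. For a terminal $T$, $\Omega[\mathcal{N},\mathcal{F},S\to T]:\mathcal{A}^{|\mathrm{out}(S)|}\to\mathcal{A}^{|\mathrm{in}(T)|}$ is the function that sends the vector of symbols emitted by $S$ on its outgoing edges to the vector of symbols arriving on the incoming edges of $T$ when every intermediate vertex $V$ applies $\mathcal{F}_V$ to its incoming symbols. An outer code is a nonempty subset $\mathcal{C}\subseteq\mathcal{A}^{|\mathrm{out}(S)|}$. The pair $(\mathcal{C},\mathcal{F})$ is unambiguous for $(\mathcal{N},\mathcal{A})$ if for every $T\in\mathbf{T}$ the function $\Omega[\mathcal{N},\mathcal{F},S\to T]$ is injective on $\mathcal{C}$. For $\mathcal{A}=\mathbb{F}_q$, the (1-shot) linear capacity is $\mathrm{C}_1^{\mathrm{lin}}(\mathcal{N},\mathcal{A})=\max\{\log_{q}|\mathcal{C}| : (\mathcal{C},\mathcal{F})\text{ is unambiguous for }(\mathcal{N},\mathcal{A})\text{ for some network code }\mathcal{F}\text{ all of whose functions }\mathcal{F}_V\text{ are }\mathbb{F}_q\text{-linear}\}$. The outer code $\mathcal{C}$ is not required to be linear. *)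

theory Defs
  imports Complex_Main "HOL-Library.FuncSet" "HOL-Library.Cardinality" "HOL-Number_Theory.Prime_Powers"
    "Graph_Theory.Graph_Theory"
begin

locale network = fin_digraph G
  for G :: "('v, 'e) pre_digraph" (structure) +
  fixes S :: 'v and Ts :: "'v set"
  assumes no_cycle: "\<nexists>p. cycle p"
    and source_in_verts: "S \<in> verts G"
    and terminals_subset: "Ts \<subseteq> verts G - {S}"
    and terminals_nonempty: "Ts \<noteq> {}"
    and source_no_in: "in_arcs G S = {}"
    and terminal_no_out: "\<And>T. T \<in> Ts \<Longrightarrow> out_arcs G T = {}"
    and source_to_terminal: "\<And>T. T \<in> Ts \<Longrightarrow> S \<rightarrow>\<^sup>* T"
    and source_to_intermediate: "\<And>V. V \<in> verts G - {S} - Ts \<Longrightarrow> S \<rightarrow>\<^sup>* V"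
    and intermediate_to_terminal:
      "\<And>V. V \<in> verts G - {S} - Ts \<Longrightarrow> \<exists>T\<in>Ts. V \<rightarrow>\<^sup>* T"
begin

definition intermediate :: "'v set" where
  "intermediate = verts G - {S} - Ts"

definition arc_pred :: "('e \<times> 'e) set" where
  "arc_pred = {(e', e). e' \<in> arcs G \<and> e \<in> arcs G \<and> head G e' = tail G e}"

lemma arc_pred_trancl:
  assumes "(e', e) \<in> arc_pred\<^sup>+"
  shows "e' \<in> arcs G \<and> e \<in> arcs G \<and> tail G e' \<rightarrow>\<^sup>+ tail G e"
  using assms
proof (induction rule: trancl_induct)
  case (base e)
  then show ?case
    unfolding arc_pred_def
    by (smt (verit, best) Product_Type.Collect_case_prodD fst_conv in_arcs_imp_in_arcs_ends
        snd_conv trancl.r_into_trancl)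
next
  case (step e e'')
  then have "e'' \<in> arcs G" "tail G e \<rightarrow> tail G e''"
    unfolding arc_pred_def by (auto dest: in_arcs_imp_in_arcs_ends)
  with step.IH show ?case
    by (meson trancl.trancl_into_trancl)
qed

lemma wf_arc_pred: "wf arc_pred"
proof (rule finite_acyclic_wf)
  show "finite arc_pred"
    by (rule finite_subset[of _ "arcs G \<times> arcs G"]) (auto simp: arc_pred_def)
  show "acyclic arc_pred"
  proof (rule acyclicI, rule allI, rule notI)
    fix e assume "(e, e) \<in> arc_pred\<^sup>+"
    then have "tail G e \<rightarrow>\<^sup>+ tail G e"
      using arc_pred_trancl by blast
    then have "\<exists>p. closed_w p"
      unfolding reachable1_awalk closed_w_def by auto
    then show False
      using closed_w_imp_cycle no_cycle by blast
  qed
qed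

text \<open>
  Vectors in \<open>A\<^bsup>|in(V)|\<^esup>\<close> and \<open>A\<^bsup>|out(V)|\<^esup>\<close> are extensional functions
  on the set of arcs itself, so the coordinates are indexed by arcs and no total order on the arcs is needed.
\<close>

definition network_code :: "'a set \<Rightarrow> ('v \<Rightarrow> ('e \<Rightarrow> 'a) \<Rightarrow> ('e \<Rightarrow> 'a)) \<Rightarrow> bool" where
  "network_code A F \<longleftrightarrow>
    (\<forall>V\<in>intermediate. F V \<in> (in_arcs G V \<rightarrow>\<^sub>E A) \<rightarrow> (out_arcs G V \<rightarrow>\<^sub>E A))"

lemma restrict_fundef_cong [fundef_cong]:
  "A = B \<Longrightarrow> (\<And>i. i \<in> B \<Longrightarrow> f i = g i) \<Longrightarrow> restrict f A = restrict g B"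
  by (auto simp: restrict_def fun_eq_iff)

text \<open>
  \<open>symbol F x e\<close> is the symbol carried by the arc \<open>e\<close> when \<open>S\<close> emits \<open>x\<close>. Arcs leave only
  the source and intermediate vertices, so the first branch is the one of the intermediate
  vertices.
\<close>

function symbol ::
  "('v \<Rightarrow> ('e \<Rightarrow> 'a) \<Rightarrow> ('e \<Rightarrow> 'a)) \<Rightarrow> ('e \<Rightarrow> 'a) \<Rightarrow> 'e \<Rightarrow> 'a" where
  "symbol F x e =
    (if e \<in> arcs G \<and> tail G e \<noteq> S
     then F (tail G e) (\<lambda>e'\<in>in_arcs G (tail G e). symbol F x e') e
     else x e)"
  by pat_completeness auto
termination
proof (relation "inv_image arc_pred (\<lambda>(F, x, e). e)")
  show "wf (inv_image arc_pred (\<lambda>(F, x, e). e))"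
    by (intro wf_inv_image wf_arc_pred)
qed (auto simp: arc_pred_def)

declare symbol.simps [simp del]

definition transfer ::
  "('v \<Rightarrow> ('e \<Rightarrow> 'a) \<Rightarrow> ('e \<Rightarrow> 'a)) \<Rightarrow> 'v \<Rightarrow> ('e \<Rightarrow> 'a) \<Rightarrow> ('e \<Rightarrow> 'a)" where
  "transfer F T x = (\<lambda>e\<in>in_arcs G T. symbol F x e)"

definition outer_code :: "'a set \<Rightarrow> ('e \<Rightarrow> 'a) set \<Rightarrow> bool" where
  "outer_code A C \<longleftrightarrow> C \<noteq> {} \<and> C \<subseteq> (out_arcs G S \<rightarrow>\<^sub>E A)"

definition unambiguous ::
  "'a set \<Rightarrow> ('e \<Rightarrow> 'a) set \<Rightarrow> ('v \<Rightarrow> ('e \<Rightarrow> 'a) \<Rightarrow> ('e \<Rightarrow> 'a)) \<Rightarrow> bool" where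
  "unambiguous A C F \<longleftrightarrow>
    outer_code A C \<and> network_code A F \<and> (\<forall>T\<in>Ts. inj_on (transfer F T) C)"

definition linear_network_code ::
  "('v \<Rightarrow> ('e \<Rightarrow> 'a::field) \<Rightarrow> ('e \<Rightarrow> 'a)) \<Rightarrow> bool" where
  "linear_network_code F \<longleftrightarrow> network_code UNIV F \<and>
    (\<forall>V\<in>intermediate. \<forall>x \<in> in_arcs G V \<rightarrow>\<^sub>E UNIV.
      (\<forall>y \<in> in_arcs G V \<rightarrow>\<^sub>E UNIV.
        F V (\<lambda>e\<in>in_arcs G V. x e + y e) = (\<lambda>e\<in>out_arcs G V. F V x e + F V y e)) \<and>
      (\<forall>c. F V (\<lambda>e\<in>in_arcs G V. c * x e) = (\<lambda>e\<in>out_arcs G V. c * F V x e)))"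

definition linear_capacity :: "'a::{field,finite} itself \<Rightarrow> real" where
  "linear_capacity _ =
    Max {log (real CARD('a)) (real (card C)) | (C :: ('e \<Rightarrow> 'a) set) F.
      unambiguous UNIV C F \<and> linear_network_code F}"

text \<open>\<open>Max\<close> is specified only on finite nonempty sets; the next two lemmas show that
  the set above is one.\<close>

lemma finite_linear_rates:
  "finite {log (real CARD('a)) (real (card C)) | (C :: ('e \<Rightarrow> 'a::{field,finite}) set) F.
    unambiguous UNIV C F \<and> linear_network_code F}"
proof -
  have "finite (out_arcs G S \<rightarrow>\<^sub>E (UNIV :: 'a set))"
    by (intro finite_PiE) (auto simp: out_arcs_def)
  then have "finite ((\<lambda>C. log (real CARD('a)) (real (card C))) `
      Pow (out_arcs G S \<rightarrow>\<^sub>E (UNIV :: 'a set)))"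
    by blast
  then show ?thesis
    by (rule rev_finite_subset) (auto simp: unambiguous_def outer_code_def)
qed

lemma linear_rates_nonempty:
  "{log (real CARD('a)) (real (card C)) | (C :: ('e \<Rightarrow> 'a::{field,finite}) set) F.
    unambiguous UNIV C F \<and> linear_network_code F} \<noteq> {}"
proof -
  have "unambiguous UNIV {\<lambda>e\<in>out_arcs G S. 0 :: 'a} (\<lambda>V _. \<lambda>e\<in>out_arcs G V. 0)"
    by (auto simp: unambiguous_def outer_code_def network_code_def)
  moreover have "linear_network_code (\<lambda>V _. \<lambda>e\<in>out_arcs G V. 0 :: 'a)"
    by (auto simp: linear_network_code_def network_code_def fun_eq_iff restrict_def)
  ultimately show ?thesis by blast
qed

end

datatype comb_vertex = Source | Middle nat | Terminal "nat set"

definition comb_terminals :: "comb_vertex set" where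
  "comb_terminals = Terminal ` {I. I \<subseteq> {1..5} \<and> card I = 2}"

text \<open>There are no parallel arcs, so an arc is the pair of its ends.\<close>

definition comb_graph :: "(comb_vertex, comb_vertex \<times> comb_vertex) pre_digraph" where
  "comb_graph =
    \<lparr> verts = {Source} \<union> Middle ` {1..5} \<union> comb_terminals,
      arcs = {(Source, Middle i) | i. i \<in> {1..5}} \<union>
        {(Middle i, Terminal {i, j}) | i j. i \<in> {1..5} \<and> j \<in> {1..5} \<and> i \<noteq> j},
      tail = fst, head = snd \<rparr>"

lemma fin_digraph_comb_graph: "fin_digraph comb_graph"
proof
  fix e assume "e \<in> arcs comb_graph"
  then show "tail comb_graph e \<in> verts comb_graph" "head comb_graph e \<in> verts comb_graph"
    by (auto simp: comb_graph_def comb_terminals_def)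
next
  show fin: "finite (verts comb_graph)"
    unfolding comb_graph_def comb_terminals_def
    by (auto intro!: finite_imageI finite_subset[of _ "Pow {1..5::nat}"])
  show "finite (arcs comb_graph)"
    by (rule finite_subset[OF _ finite_cartesian_product[OF fin fin]])
      (auto simp: comb_graph_def comb_terminals_def)
qed

fun comb_level :: "comb_vertex \<Rightarrow> nat" where
  "comb_level Source = 0"
| "comb_level (Middle i) = 1"
| "comb_level (Terminal I) = 2"

lemma comb_graph_no_cycle: "\<not> pre_digraph.cycle comb_graph p"
proof
  interpret fin_digraph comb_graph by (rule fin_digraph_comb_graph)
  assume "cycle p"
  then obtain u where "awalk u p u" "p \<noteq> []"
    by (auto simp: cycle_def)
  then have "(u, u) \<in> (arcs_ends comb_graph)\<^sup>+"
    using reachable1_awalk by blast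
  moreover have "(a, b) \<in> (arcs_ends comb_graph)\<^sup>+ \<Longrightarrow> comb_level a < comb_level b" for a b
    by (induction rule: trancl_induct) (fastforce simp: arcs_ends_conv comb_graph_def)+
  ultimately show False by blast
qed

lemma network_comb_graph: "network comb_graph Source comb_terminals"
proof -
  interpret fin_digraph comb_graph by (rule fin_digraph_comb_graph)
  have SM: "Source \<rightarrow>\<^bsub>comb_graph\<^esub> Middle i" if "i \<in> {1..5}" for i
    using that by (force simp: arcs_ends_conv comb_graph_def)
  have MT: "Middle i \<rightarrow>\<^bsub>comb_graph\<^esub> Terminal {i, j}"
    if "i \<in> {1..5}" "j \<in> {1..5}" "i \<noteq> j" for i j
    using that by (force simp: arcs_ends_conv comb_graph_def)
  show ?thesis
  proof
    show "\<nexists>p. cycle p" using comb_graph_no_cycle by blast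
    show "Source \<in> verts comb_graph" by (simp add: comb_graph_def)
    show "comb_terminals \<subseteq> verts comb_graph - {Source}"
      by (auto simp: comb_graph_def comb_terminals_def)
    have "{1, 2} \<subseteq> {1..5::nat} \<and> card {1, 2::nat} = 2" by auto
    then show "comb_terminals \<noteq> {}" unfolding comb_terminals_def by blast
    show "in_arcs comb_graph Source = {}" by (auto simp: in_arcs_def comb_graph_def)
  next
    fix T assume T: "T \<in> comb_terminals"
    show "out_arcs comb_graph T = {}"
      using T by (auto simp: out_arcs_def comb_graph_def comb_terminals_def)
    obtain i j where "T = Terminal {i, j}" "i \<in> {1..5}" "j \<in> {1..5}" "i \<noteq> j"
      using T by (auto simp: comb_terminals_def card_2_iff)
    then have "Source \<rightarrow>\<^sup>+\<^bsub>comb_graph\<^esub> T"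
      using SM MT by (meson trancl.simps)
    then show "Source \<rightarrow>\<^sup>*\<^bsub>comb_graph\<^esub> T" by (rule reachable1_reachable)
  next
    fix V assume "V \<in> verts comb_graph - {Source} - comb_terminals"
    then obtain i where i: "V = Middle i" "i \<in> {1..5}"
      by (auto simp: comb_graph_def)
    show "Source \<rightarrow>\<^sup>*\<^bsub>comb_graph\<^esub> V"
      using SM[OF i(2)] i(1) by (simp add: reachable_adjI)
    obtain j :: nat where j: "j \<in> {1..5}" "i \<noteq> j"
      by (cases "i = 1") (auto intro: that[of 1] that[of 2])
    have "Terminal {i, j} \<in> comb_terminals"
      using i j by (auto simp: comb_terminals_def)
    moreover have "V \<rightarrow>\<^sup>*\<^bsub>comb_graph\<^esub> Terminal {i, j}"
      using MT i j by (simp add: reachable_adjI)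
    ultimately show "\<exists>T\<in>comb_terminals. V \<rightarrow>\<^sup>*\<^bsub>comb_graph\<^esub> T" by blast
  qed
qed

end

theory Submission
  imports Defs "HOL-Analysis.Convex"
begin

text \<open>
  A middle vertex receives a single symbol, so the terminal \<open>T\<^bsub>{i,j}\<^esub>\<close> sees at most the
  coordinates \<open>i\<close> and \<open>j\<close> of the emitted word, and exactly these when every middle vertex forwards
  its symbol. Hence the attainable outer codes are, whether or not the network code is linear,
  the codes of length 5 with minimum distance at least 4. Their size is at most \<open>q\<^sup>2\<close> by the
  Singleton bound and satisfies \<open>5 M \<le> q (M + 4)\<close> by the Plotkin bound, that is, \<open>M \<le> 2\<close> for
  \<open>q = 2\<close> and \<open>M \<le> 6\<close> for \<open>q = 3\<close>. These bounds are attained by the repetition code for \<open>q = 2\<close>,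
  by a code derived from a one-factorization of \<open>K\<^sub>6\<close> for \<open>q = 3\<close>, and by an extended
  Reed-Solomon code for \<open>q \<ge> 4\<close>.
\<close>

section \<open>Counting agreements: the Plotkin and Singleton bounds\<close>

lemma sum_agreements_eq_sum_fibre_squares:
  fixes f :: "'b \<Rightarrow> 'a::finite"
  shows "(\<Sum>x\<in>C. \<Sum>y\<in>C. of_bool (f x = f y)) =
    (\<Sum>a\<in>UNIV. (\<Sum>x\<in>C. of_bool (f x = a))\<^sup>2 :: real)"
proof -
  have "(\<Sum>a\<in>UNIV. (\<Sum>x\<in>C. of_bool (f x = a))\<^sup>2 :: real) =
      (\<Sum>a\<in>UNIV. \<Sum>x\<in>C. \<Sum>y\<in>C. of_bool (f x = a) * of_bool (f y = a))"
    by (simp add: power2_eq_square sum_product)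
  also have "\<dots> = (\<Sum>x\<in>C. \<Sum>y\<in>C. \<Sum>a\<in>UNIV. of_bool (f x = a) * of_bool (f y = a))"
    by (subst sum.swap, rule sum.cong[OF refl], subst sum.swap, rule refl)
  also have "\<dots> = (\<Sum>x\<in>C. \<Sum>y\<in>C. of_bool (f x = f y))"
  proof (intro sum.cong refl)
    fix x y
    \<comment> \<open>Only the symbol \<open>a = f x\<close> can contribute, so the sum collapses to
      one term.\<close>
    have "(\<Sum>a\<in>UNIV. of_bool (f x = a) * of_bool (f y = a) :: real) =
        (\<Sum>a\<in>UNIV. if f x = a then of_bool (f y = f x) else 0)"
      by (intro sum.cong) auto
    then show "(\<Sum>a\<in>UNIV. of_bool (f x = a) * of_bool (f y = a)) = (of_bool (f x = f y) :: real)"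
      by auto
  qed
  finally show ?thesis by simp
qed

text \<open>Cauchy-Schwarz for the fibre sizes of \<open>f\<close>: they add up to
  \<open>card C\<close>, and the sum of their squares counts the agreeing ordered pairs.\<close>

lemma square_card_le_agreements:
  fixes f :: "'b \<Rightarrow> 'a::finite"
  assumes "finite C"
  shows "(real (card C))\<^sup>2 \<le> real CARD('a) * (\<Sum>x\<in>C. \<Sum>y\<in>C. of_bool (f x = f y))"
proof -
  have "real (card C) = (\<Sum>x\<in>C. \<Sum>a\<in>UNIV. of_bool (f x = a))"
    by simp
  also have "\<dots> = (\<Sum>a\<in>UNIV. \<Sum>x\<in>C. of_bool (f x = a))"
    by (rule sum.swap)
  finally have "(real (card C))\<^sup>2 \<le> (\<Sum>a\<in>UNIV. (\<Sum>x\<in>C. of_bool (f x = a))\<^sup>2) * real CARD('a)"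
    using sum_squared_le_sum_of_squares[of "\<lambda>a. \<Sum>x\<in>C. of_bool (f x = a) :: real" UNIV]
    by simp
  then show ?thesis
    by (simp add: sum_agreements_eq_sum_fibre_squares mult.commute)
qed

text \<open>Double counting of the triples \<open>(x, y, i)\<close> with
  \<open>w x i = w y i\<close>. With M words over q symbols, each coordinate contributes at least
  M^2 / q of them. Each word \<open>x\<close> contributes at most \<open>card I\<close> through
  \<open>y = x\<close> and at most \<open>t\<close> through every other \<open>y\<close>. Cancelling
  one factor M gives the bound.\<close>

lemma plotkin_bound:
  fixes w :: "'b \<Rightarrow> 'i \<Rightarrow> 'a::finite"
  assumes "finite C" "C \<noteq> {}" "finite I"
    and agree: "\<And>x y. x \<in> C \<Longrightarrow> y \<in> C \<Longrightarrow> x \<noteq> y \<Longrightarrow> card {i\<in>I. w x i = w y i} \<le> t"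
  shows "card I * card C \<le> CARD('a) * (card I + t * (card C - 1))"
proof -
  have row: "(\<Sum>y\<in>C. \<Sum>i\<in>I. of_bool (w x i = w y i)) \<le> real (card I + t * (card C - 1))"
    if x: "x \<in> C" for x
  proof -
    have "(\<Sum>y\<in>C - {x}. \<Sum>i\<in>I. of_bool (w x i = w y i)) \<le> (\<Sum>y\<in>C - {x}. real t)"
    proof (rule sum_mono)
      fix y assume y: "y \<in> C - {x}"
      have "(\<Sum>i\<in>I. of_bool (w x i = w y i)) = real (card {i\<in>I. w x i = w y i})"
        using \<open>finite I\<close> by (simp add: sum.If_cases of_bool_def Collect_conj_eq Int_commute)
      then show "(\<Sum>i\<in>I. of_bool (w x i = w y i)) \<le> real t"
        using agree[of x y] x y by auto
    qed
    then show ?thesis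
      using x \<open>finite C\<close> by (subst sum.remove[of _ x]) (simp_all add: mult.commute)
  qed
  let ?M = "real (card C)"
  have "real (card I) * ?M\<^sup>2 = (\<Sum>i\<in>I. ?M\<^sup>2)"
    by simp
  also have "\<dots> \<le> (\<Sum>i\<in>I. real CARD('a) * (\<Sum>x\<in>C. \<Sum>y\<in>C. of_bool (w x i = w y i)))"
    by (intro sum_mono square_card_le_agreements \<open>finite C\<close>)
  also have "\<dots> = real CARD('a) * (\<Sum>i\<in>I. \<Sum>x\<in>C. \<Sum>y\<in>C. of_bool (w x i = w y i))"
    by (simp add: sum_distrib_left)
  also have "(\<Sum>i\<in>I. \<Sum>x\<in>C. \<Sum>y\<in>C. of_bool (w x i = w y i) :: real) =
      (\<Sum>x\<in>C. \<Sum>y\<in>C. \<Sum>i\<in>I. of_bool (w x i = w y i))"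
    by (subst sum.swap, rule sum.cong[OF refl], subst sum.swap, rule refl)
  also have "\<dots> \<le> (\<Sum>x\<in>C. real (card I + t * (card C - 1)))"
    using row by (rule sum_mono)
  finally have "?M * real (card I * card C) \<le> ?M * real (CARD('a) * (card I + t * (card C - 1)))"
    by (simp add: power2_eq_square mult_ac mult_left_mono)
  moreover have "?M > 0"
    using assms by (simp add: card_gt_0_iff)
  ultimately show ?thesis
    by (simp only: mult_le_cancel_left_pos of_nat_le_iff)
qed

text \<open>Minimum distance at least 4, phrased for an indexed family of words: the index may be an
  emitted word itself, as for outer codes, or a message, as for the explicit constructions.\<close>

definition pairwise_determined :: "'b set \<Rightarrow> ('b \<Rightarrow> nat \<Rightarrow> 'a) \<Rightarrow> bool" where
  "pairwise_determined C w \<longleftrightarrow>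
    (\<forall>i\<in>{1..5}. \<forall>j\<in>{1..5}. i \<noteq> j \<longrightarrow> inj_on (\<lambda>x. (w x i, w x j)) C)"

lemma pairwise_determined_Singleton_bound:
  fixes w :: "'b \<Rightarrow> nat \<Rightarrow> 'a::finite"
  assumes "pairwise_determined C w"
  shows "card C \<le> CARD('a)\<^sup>2"
proof -
  have "inj_on (\<lambda>x. (w x 1, w x 2)) C"
    using assms by (simp add: pairwise_determined_def)
  then have "card C \<le> card (UNIV :: ('a \<times> 'a) set)"
    by (rule card_inj_on_le) auto
  then show ?thesis
    by (simp add: power2_eq_square)
qed

text \<open>Two agreements would already identify the words, so \<open>plotkin_bound\<close> applies
  with \<open>t = 1\<close>.\<close>

lemma pairwise_determined_Plotkin_bound:
  fixes w :: "'b \<Rightarrow> nat \<Rightarrow> 'a::finite"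
  assumes w: "pairwise_determined C w" and C: "finite C" "C \<noteq> {}"
  shows "5 * card C \<le> CARD('a) * (card C + 4)"
proof -
  have "card {i\<in>{1..5}. w x i = w y i} \<le> 1" if "x \<in> C" "y \<in> C" "x \<noteq> y" for x y
  proof -
    have "i = j" if "i \<in> {1..5}" "w x i = w y i" "j \<in> {1..5}" "w x j = w y j" for i j
      using w that \<open>x \<in> C\<close> \<open>y \<in> C\<close> \<open>x \<noteq> y\<close> unfolding pairwise_determined_def inj_on_def by blast
    then show ?thesis
      by (auto simp: card_le_Suc0_iff_eq)
  qed
  from plotkin_bound[OF C _ this] have "5 * card C \<le> CARD('a) * (5 + (card C - 1))"
    by simp
  \<comment> \<open>The subtraction is truncated; only for a nonempty code is
    \<open>5 + (card C - 1)\<close> equal to \<open>card C + 4\<close>.\<close>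
  moreover have "card C \<ge> 1"
    using C by (simp add: Suc_le_eq card_gt_0_iff)
  ultimately show ?thesis
    by (simp add: add.commute)
qed

section \<open>Unambiguous pairs on the combination network\<close>

interpretation comb: network comb_graph Source comb_terminals
  by (rule network_comb_graph)

lemma comb_intermediate: "comb.intermediate = Middle ` {1..5}"
  unfolding comb.intermediate_def by (auto simp: comb_graph_def comb_terminals_def)

lemma comb_out_arcs_Source: "out_arcs comb_graph Source = {(Source, Middle i) | i. i \<in> {1..5}}"
  by (auto simp: out_arcs_def comb_graph_def)

lemma comb_in_arcs_Middle: "i \<in> {1..5} \<Longrightarrow> in_arcs comb_graph (Middle i) = {(Source, Middle i)}"
  by (auto simp: in_arcs_def comb_graph_def)

lemma comb_in_arcs_Terminal:
  assumes "i \<in> {1..5}" "j \<in> {1..5}" "i \<noteq> j"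
  shows "in_arcs comb_graph (Terminal {i, j}) =
    {(Middle i, Terminal {i, j}), (Middle j, Terminal {i, j})}"
  using assms by (auto simp: in_arcs_def comb_graph_def doubleton_eq_iff)

lemma comb_symbol_Source: "comb.symbol F x (Source, V) = x (Source, V)"
  by (subst comb.symbol.simps) (simp add: comb_graph_def)

lemma comb_symbol_Middle:
  assumes "i \<in> {1..5}" "j \<in> {1..5}" "i \<noteq> j"
  shows "comb.symbol F x (Middle i, Terminal {i, j}) =
    F (Middle i) (\<lambda>e\<in>{(Source, Middle i)}. x e) (Middle i, Terminal {i, j})"
proof -
  have "(Middle i, Terminal {i, j}) \<in> arcs comb_graph"
    "tail comb_graph (Middle i, Terminal {i, j}) = Middle i"
    using assms by (auto simp: comb_graph_def)
  moreover have "(\<lambda>e\<in>{(Source, Middle i)}. comb.symbol F x e) = (\<lambda>e\<in>{(Source, Middle i)}. x e)"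
    by (auto simp: comb_symbol_Source)
  ultimately show ?thesis
    using comb_in_arcs_Middle[OF assms(1)] by (subst comb.symbol.simps) simp
qed

text \<open>Whatever the middle vertices compute, each of the two symbols reaching the terminal is a
  function of one emitted symbol, so words that agree at both coordinates cannot be told
  apart.\<close>

lemma inj_on_comb_transfer_imp:
  assumes ij: "i \<in> {1..5}" "j \<in> {1..5}" "i \<noteq> j"
    and inj: "inj_on (comb.transfer F (Terminal {i, j})) C"
  shows "inj_on (\<lambda>x. (x (Source, Middle i), x (Source, Middle j))) C"
proof (rule inj_onI)
  fix x y assume xy: "x \<in> C" "y \<in> C"
    and "(x (Source, Middle i), x (Source, Middle j)) = (y (Source, Middle i), y (Source, Middle j))"
  then have eq: "(\<lambda>e\<in>{(Source, Middle i)}. x e) = (\<lambda>e\<in>{(Source, Middle i)}. y e)"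
    "(\<lambda>e\<in>{(Source, Middle j)}. x e) = (\<lambda>e\<in>{(Source, Middle j)}. y e)"
    by auto
  \<comment> \<open>The arc from \<open>Middle j\<close> needs the symbol lemma with
    \<open>i\<close> and \<open>j\<close> exchanged; \<open>insert_commute\<close> then identifies
    the terminals of \<open>{j, i}\<close> and \<open>{i, j}\<close>.\<close>
  have "comb.transfer F (Terminal {i, j}) x = comb.transfer F (Terminal {i, j}) y"
    using comb_symbol_Middle[OF ij, of F] comb_symbol_Middle[of j i F] ij eq
    unfolding comb.transfer_def comb_in_arcs_Terminal[OF ij]
    by (intro restrict_ext) (auto simp: insert_commute)
  with inj xy show "x = y"
    by (auto dest: inj_onD)
qed

lemma Terminal_in_comb_terminals:
  "i \<in> {1..5} \<Longrightarrow> j \<in> {1..5} \<Longrightarrow> i \<noteq> j \<Longrightarrow> Terminal {i, j} \<in> comb_terminals"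
  by (auto simp: comb_terminals_def)

lemma unambiguous_imp_pairwise_determined:
  assumes "comb.unambiguous A C F"
  shows "pairwise_determined C (\<lambda>x i. x (Source, Middle i))"
  using assms inj_on_comb_transfer_imp Terminal_in_comb_terminals
  unfolding pairwise_determined_def comb.unambiguous_def by blast

text \<open>Reading the arc \<open>(Source, V)\<close> is meaningful because it is the only incoming
  arc of a middle vertex, and network codes are applied only there.\<close>

definition forward_code ::
  "comb_vertex \<Rightarrow> (comb_vertex \<times> comb_vertex \<Rightarrow> 'a) \<Rightarrow> (comb_vertex \<times> comb_vertex \<Rightarrow> 'a)" where
  "forward_code V x = (\<lambda>e\<in>out_arcs comb_graph V. x (Source, V))"

lemma linear_forward_code: "comb.linear_network_code forward_code"
proof -
  \<comment> \<open>Sums and scalar multiples are restricted to \<open>in_arcs\<close>, so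
    evaluating them at this arc requires its membership; \<open>in_in_arcs_conv\<close> is removed
    to keep simp from unfolding it.\<close>
  have "(Source, Middle i) \<in> in_arcs comb_graph (Middle i)" if "i \<in> {1..5}" for i
    using comb_in_arcs_Middle[OF that] by blast
  then show ?thesis
    by (simp del: in_in_arcs_conv add: comb.linear_network_code_def comb.network_code_def
        comb_intermediate forward_code_def cong: restrict_cong)
qed

lemma inj_on_comb_transfer_forward:
  assumes ij: "i \<in> {1..5}" "j \<in> {1..5}" "i \<noteq> j"
    and inj: "inj_on (\<lambda>x. (x (Source, Middle i), x (Source, Middle j))) C"
  shows "inj_on (comb.transfer forward_code (Terminal {i, j})) C"
proof (rule inj_onI)
  fix x y assume xy: "x \<in> C" "y \<in> C"
    and eq: "comb.transfer forward_code (Terminal {i, j}) x =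
      comb.transfer forward_code (Terminal {i, j}) y"
  have symbol: "comb.symbol forward_code z (Middle k, Terminal {i, j}) = z (Source, Middle k)"
    if "k \<in> {i, j}" for k and z :: "comb_vertex \<times> comb_vertex \<Rightarrow> 'a"
  proof -
    have "(Middle k, Terminal {i, j}) \<in> out_arcs comb_graph (Middle k)"
      using that ij by (auto simp: comb_graph_def)
    then show ?thesis
      using that ij comb_symbol_Middle[OF ij, of forward_code z]
        comb_symbol_Middle[of j i forward_code z]
      by (auto simp: forward_code_def insert_commute)
  qed
  have "x (Source, Middle k) = y (Source, Middle k)" if "k \<in> {i, j}" for k
    using fun_cong[OF eq, of "(Middle k, Terminal {i, j})"] symbol[OF that] that
    unfolding comb.transfer_def comb_in_arcs_Terminal[OF ij] by auto
  with inj xy show "x = y"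
    by (auto dest: inj_onD)
qed

text \<open>Converse of \<open>unambiguous_imp_pairwise_determined\<close>, realized by forwarding.
  Two coordinates already separate the indices, so distinct indices yield distinct emitted words and
  the size is kept.\<close>

lemma pairwise_determined_imp_unambiguous:
  fixes w :: "'b \<Rightarrow> nat \<Rightarrow> 'a::field"
  assumes w: "pairwise_determined J w" and "J \<noteq> {}"
  obtains C :: "(comb_vertex \<times> comb_vertex \<Rightarrow> 'a) set"
    where "comb.unambiguous UNIV C forward_code" "card C = card J"
proof -
  \<comment> \<open>An arc out of \<open>Source\<close> determines its middle vertex, so
    \<open>THE\<close> recovers the coordinate.\<close>
  define word where
    "word s = (\<lambda>e\<in>out_arcs comb_graph Source. w s (THE i. e = (Source, Middle i)))" for s
  have word: "word s (Source, Middle i) = w s i" if "i \<in> {1..5}" for s i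
    using that by (auto simp: word_def comb_out_arcs_Source)
  have inj: "inj_on (\<lambda>x. (x (Source, Middle i), x (Source, Middle j))) (word ` J)"
    if "i \<in> {1..5}" "j \<in> {1..5}" "i \<noteq> j" for i j
  proof -
    have "inj_on (\<lambda>s. (w s i, w s j)) J"
      using w that by (simp add: pairwise_determined_def)
    then show ?thesis
      using word[OF that(1)] word[OF that(2)] by (auto simp: inj_on_def)
  qed
  have "inj_on (comb.transfer forward_code T) (word ` J)" if T: "T \<in> comb_terminals" for T
  proof -
    obtain i j where "T = Terminal {i, j}" "i \<in> {1..5}" "j \<in> {1..5}" "i \<noteq> j"
      using T by (auto simp: comb_terminals_def card_2_iff)
    then show ?thesis
      using inj inj_on_comb_transfer_forward by blast
  qed
  then have "comb.unambiguous UNIV (word ` J) forward_code"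
    using linear_forward_code \<open>J \<noteq> {}\<close>
    by (auto simp: comb.unambiguous_def comb.outer_code_def comb.linear_network_code_def word_def)
  moreover have "inj_on word J"
  proof (rule inj_onI)
    fix s t assume st: "s \<in> J" "t \<in> J" and eq: "word s = word t"
    have "w s i = w t i" if "i \<in> {1..5}" for i
      using eq word[OF that] by metis
    then have "w s 1 = w t 1" "w s 2 = w t 2"
      by auto
    moreover have "inj_on (\<lambda>x. (w x 1, w x 2)) J"
      using w by (simp add: pairwise_determined_def)
    ultimately show "s = t"
      using st by (simp add: inj_on_def)
  qed
  ultimately show ?thesis
    using that card_image by blast
qed

text \<open>Turns the capacity into a pure coding problem. The witness may be indexed by any type,
  while the upper bound is asked only for sets of emitted words.\<close>

lemma comb_linear_capacity_eqI:
  fixes w :: "'b \<Rightarrow> nat \<Rightarrow> 'a::{field,finite}"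
  assumes w: "pairwise_determined J w" "J \<noteq> {}" "card J = m"
    and bound: "\<And>(C :: (comb_vertex \<times> comb_vertex \<Rightarrow> 'a) set) v :: _ \<Rightarrow> nat \<Rightarrow> 'a.
      finite C \<Longrightarrow> C \<noteq> {} \<Longrightarrow> pairwise_determined C v \<Longrightarrow> card C \<le> m"
  shows "comb.linear_capacity TYPE('a) = log (real CARD('a)) (real m)"
  unfolding comb.linear_capacity_def
proof (rule Max_eqI[OF comb.finite_linear_rates])
  have "CARD('a) > 1"
    using card_mono[of "UNIV :: 'a set" "{0, 1}"] by simp
  fix r assume "r \<in> {log (real CARD('a)) (real (card C)) |
    (C :: (comb_vertex \<times> comb_vertex \<Rightarrow> 'a) set) F.
      comb.unambiguous UNIV C F \<and> comb.linear_network_code F}"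
  then obtain C :: "(comb_vertex \<times> comb_vertex \<Rightarrow> 'a) set" and F
    where r: "r = log (real CARD('a)) (real (card C))" and CF: "comb.unambiguous UNIV C F"
    by blast
  have "finite (out_arcs comb_graph Source \<rightarrow>\<^sub>E (UNIV :: 'a set))"
    by (intro finite_PiE) (auto simp: out_arcs_def)
  with CF have C: "finite C" "C \<noteq> {}"
    by (auto simp: comb.unambiguous_def comb.outer_code_def dest: finite_subset)
  then have "card C \<le> m" "card C > 0"
    using bound unambiguous_imp_pairwise_determined[OF CF] by (auto simp: card_gt_0_iff)
  then show "r \<le> log (real CARD('a)) (real m)"
    unfolding r using \<open>CARD('a) > 1\<close> by simp
next
  obtain C :: "(comb_vertex \<times> comb_vertex \<Rightarrow> 'a) set"
    where "comb.unambiguous UNIV C forward_code" "card C = m"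
    using pairwise_determined_imp_unambiguous[OF w(1,2)] w(3) by metis
  then show "log (real CARD('a)) (real m) \<in> {log (real CARD('a)) (real (card C)) |
    (C :: (comb_vertex \<times> comb_vertex \<Rightarrow> 'a) set) F.
      comb.unambiguous UNIV C F \<and> comb.linear_network_code F}"
    using linear_forward_code by blast
qed

section \<open>Codes attaining the bounds\<close>

lemma pairwise_determined_repetition: "pairwise_determined UNIV (\<lambda>a i. a)"
  by (auto simp: pairwise_determined_def inj_on_def)

text \<open>The word of \<open>(a, b)\<close> lists the values of the polynomial a + b X at four
  distinct points, followed by its value b at infinity. Subtracting two finite values isolates
  \<open>b\<close>.\<close>

lemma pairwise_determined_Reed_Solomon:
  fixes \<alpha> :: "nat \<Rightarrow> 'a::field"
  assumes "inj_on \<alpha> {1..4}"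
  shows "pairwise_determined UNIV (\<lambda>(a, b) i. if i = 5 then b else a + \<alpha> i * b)"
proof -
  have affine: "b = b'"
    if "a + \<alpha> i * b = a' + \<alpha> i * b'" "a + \<alpha> j * b = a' + \<alpha> j * b'"
      "i \<in> {1..4}" "j \<in> {1..4}" "i \<noteq> j" for a b a' b' i j
  proof -
    have "(\<alpha> i - \<alpha> j) * (b - b') = 0"
      using that(1,2) by algebra
    moreover have "\<alpha> i \<noteq> \<alpha> j"
      using assms that by (auto dest: inj_onD)
    ultimately show ?thesis
      by simp
  qed
  have snd: "b = b'"
    if "i \<in> {1..5}" "j \<in> {1..5}" "i \<noteq> j"
      "(if i = 5 then b else a + \<alpha> i * b) = (if i = 5 then b' else a' + \<alpha> i * b')"
      "(if j = 5 then b else a + \<alpha> j * b) = (if j = 5 then b' else a' + \<alpha> j * b')"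
    for a b a' b' i j
  proof (cases "i = 5 \<or> j = 5")
    case False
    then have "i \<in> {1..4}" "j \<in> {1..4}"
      using that(1,2) by auto
    then show ?thesis
      using affine False that(3-5) by auto
  qed (use that in auto)
  show ?thesis
    unfolding pairwise_determined_def
  proof (intro ballI impI inj_onI, clarify)
    fix i j :: nat and a b a' b' :: 'a
    assume ij: "i \<in> {1..5}" "j \<in> {1..5}" "i \<noteq> j"
      and eq: "(if i = 5 then b else a + \<alpha> i * b) = (if i = 5 then b' else a' + \<alpha> i * b')"
      "(if j = 5 then b else a + \<alpha> j * b) = (if j = 5 then b' else a' + \<alpha> j * b')"
    \<comment> \<open>Once \<open>b = b'\<close>, a coordinate other than 5 yields
      \<open>a = a'\<close>; at least one of \<open>i\<close> and \<open>j\<close> is such a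
      coordinate.\<close>
    from snd[OF ij eq] eq ij show "a = a' \<and> b = b'"
      by (cases "i = 5") auto
  qed
qed

text \<open>
  The words are the vertices of \<open>K\<^sub>6\<close>, namely the residues modulo 5 and a point 5 at infinity, and the
  \<open>i\<close>-th coordinate tells the three edges of the \<open>i\<close>-th one-factor
  \<open>{\<infinity>, i}, {i - 1, i + 1}, {i - 2, i + 2}\<close> apart by the squares 0, 1, 4 modulo 5.
\<close>

lemma pairwise_determined_one_factorization:
  fixes \<beta> :: "int \<Rightarrow> 'a"
  assumes "inj_on \<beta> {0, 1, 4}"
  shows "pairwise_determined {0..5}
    (\<lambda>s i. \<beta> (if s = 5 then 0 else (s - int i)\<^sup>2 mod 5))"
proof -
  let ?v = "\<lambda>s i. if s = 5 then 0 else (s - int i)\<^sup>2 mod 5"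
  have six: "{0..5::int} = {0, 1, 2, 3, 4, 5}" and five: "{1..5::nat} = {1, 2, 3, 4, 5}"
    by auto
  \<comment> \<open>All labels are squares modulo 5, where \<beta> is injective, so \<beta> can be
    stripped.\<close>
  have "?v s i \<in> {0, 1, 4}" if "s \<in> {0..5}" "i \<in> {1..5}" for s i
    using that unfolding six five by auto
  then have v: "?v s i = ?v t i" if "\<beta> (?v s i) = \<beta> (?v t i)"
    "s \<in> {0..5}" "t \<in> {0..5}" "i \<in> {1..5}" for s t i
    using inj_onD[OF assms that(1)] that(2-4) by blast
  \<comment> \<open>Distinct one-factors share no edge, so two vertices have equal labels in at most
    one coordinate; this is checked case by case.\<close>
  have "\<forall>i\<in>{1..5}. \<forall>j\<in>{1..5}. i \<noteq> j \<longrightarrow>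
    (\<forall>s\<in>{0..5}. \<forall>t\<in>{0..5}. ?v s i = ?v t i \<longrightarrow> ?v s j = ?v t j \<longrightarrow> s = t)"
    unfolding six five by simp
  with v show ?thesis
    unfolding pairwise_determined_def inj_on_def prod.inject by blast
qed

lemma finite_inj_on_into_type:
  assumes "finite S" "card S \<le> CARD('a::finite)"
  obtains f :: "'b \<Rightarrow> 'a::finite" where "inj_on f S"
  using card_le_inj[of S "UNIV :: 'a set"] assms by auto

theorem corollary2:
  fixes q :: nat
  assumes "primepow q"
    and "CARD('a::{field,finite}) = q"
  shows "network.linear_capacity comb_graph Source comb_terminals TYPE('a) =
    (if q = 2 then 1 else if q = 3 then log 3 6 else 2)"
proof -
  note q = assms(2)
  have "q \<ge> 2"
    using primepow_gt_Suc_0[OF assms(1)] by simp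
  then consider "q = 2" | "q = 3" | "q \<ge> 4"
    by linarith
  then show ?thesis
  proof cases
    case 1
    \<comment> \<open>The Plotkin bound reads 5 M \<le> 2 (M + 4), that is, 3 M \<le> 8.\<close>
    have "comb.linear_capacity TYPE('a) = log (real CARD('a)) (real 2)"
    proof (rule comb_linear_capacity_eqI[OF pairwise_determined_repetition])
      fix C :: "(comb_vertex \<times> comb_vertex \<Rightarrow> 'a) set" and v :: "_ \<Rightarrow> nat \<Rightarrow> 'a"
      assume "finite C" "C \<noteq> {}" "pairwise_determined C v"
      then show "card C \<le> 2"
        using pairwise_determined_Plotkin_bound[of C v] q 1 by simp
    qed (use q 1 in auto)
    then show ?thesis
      using q 1 by simp
  next
    case 2
    \<comment> \<open>The three field elements serve as mere names for the squares modulo 5; the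
      outer code need not be linear.\<close>
    obtain \<beta> :: "int \<Rightarrow> 'a" where "inj_on \<beta> {0, 1, 4}"
      using finite_inj_on_into_type[of "{0, 1, 4 :: int}", where 'a = 'a] q 2 by auto
    then have "comb.linear_capacity TYPE('a) = log (real CARD('a)) (real 6)"
    proof (rule comb_linear_capacity_eqI[OF pairwise_determined_one_factorization])
      fix C :: "(comb_vertex \<times> comb_vertex \<Rightarrow> 'a) set" and v :: "_ \<Rightarrow> nat \<Rightarrow> 'a"
      assume "finite C" "C \<noteq> {}" "pairwise_determined C v"
      then show "card C \<le> 6"
        using pairwise_determined_Plotkin_bound[of C v] q 2 by simp
    qed auto
    then show ?thesis
      using q 2 by simp
  next
    case 3
    \<comment> \<open>Four distinct evaluation points exist because the field has at least four
      elements.\<close>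
    obtain \<alpha> :: "nat \<Rightarrow> 'a" where "inj_on \<alpha> {1..4}"
      using finite_inj_on_into_type[of "{1..4 :: nat}", where 'a = 'a] q 3 by auto
    then have "comb.linear_capacity TYPE('a) = log (real CARD('a)) (real (q\<^sup>2))"
    proof (rule comb_linear_capacity_eqI[OF pairwise_determined_Reed_Solomon])
      fix C :: "(comb_vertex \<times> comb_vertex \<Rightarrow> 'a) set" and v :: "_ \<Rightarrow> nat \<Rightarrow> 'a"
      assume "pairwise_determined C v"
      then show "card C \<le> q\<^sup>2"
        using pairwise_determined_Singleton_bound q by blast
    qed (use q in \<open>auto simp: power2_eq_square\<close>)
    also have "\<dots> = 2"
      using q 3 by (simp add: log_nat_power)
    finally show ?thesis
      using 3 by simp
  qed
qed

end
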